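(* Let $n\ge 8$. Then $$\beta(F_{1,n-1})=\left\lceil \frac{2(n-2)}{5}\right\rceil .$$
   Context: For a finite connected simple graph $G$, $d(u,v)$ is the length of a shortest path between $u$ and $v$; a vertex $x$ resolves $u,v$ if $d(u,x)\ne d(v,x)$; a set $S\subseteq V(G)$ is a resolving set if every pair of distinct vertices is resolved by some vertex of $S$; the metric dimension $\beta(G)$ is the minimum cardinality of a resolving set. The fan graph $F_{1,n-1}$ of order $n$ is the maximal outerplanar graph of order $n$ in which one vertex is adjacent to the $n-1$ remaining vertices (equivalently, a path on $n-1$ vertices together with one further vertex adjacent to every vertex of the path). *)

theory Defs
  imports Graph_Theory.Graph_Theory
begin

text \<open>
  Simple graphs are the \<^locale>\<open>pair_graph\<close>s, where each edge is represented by its two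
  opposite arcs.  The distance is only meaningful for vertices joined by a path.
\<close>

definition graph_dist :: "'a pair_pre_digraph \<Rightarrow> 'a \<Rightarrow> 'a \<Rightarrow> nat" where
  "graph_dist G u v = (LEAST k. \<exists>p. pre_digraph.apath (with_proj G) u p v \<and> length p = k)"

definition resolves :: "'a pair_pre_digraph \<Rightarrow> 'a \<Rightarrow> 'a \<Rightarrow> 'a \<Rightarrow> bool" where
  "resolves G x u v \<longleftrightarrow> graph_dist G u x \<noteq> graph_dist G v x"

definition resolving_set :: "'a pair_pre_digraph \<Rightarrow> 'a set \<Rightarrow> bool" where
  "resolving_set G S \<longleftrightarrow>
     S \<subseteq> pverts G \<and> (\<forall>u \<in> pverts G. \<forall>v \<in> pverts G. u \<noteq> v \<longrightarrow> (\<exists>x \<in> S. resolves G x u v))"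

definition metric_dimension :: "'a pair_pre_digraph \<Rightarrow> nat" where
  "metric_dimension G = (LEAST k. \<exists>S. resolving_set G S \<and> card S = k)"

text \<open>
  The fan of order \<open>n\<close>: the hub is \<open>0\<close>, and the remaining vertices form the path
  \<open>1, 2, \<dots>, n - 1\<close>.
\<close>

definition fan_graph :: "nat \<Rightarrow> nat pair_pre_digraph" where
  "fan_graph n =
     \<lparr> pverts = {0..<n},
       parcs = {(i, j). i < n \<and> j < n \<and> i \<noteq> j \<and> (i = 0 \<or> j = 0 \<or> j = Suc i \<or> i = Suc j)} \<rparr>"

lemma pair_graph_fan_graph: "pair_graph (fan_graph n)"
proof
  show "finite (parcs (fan_graph n))"
    by (rule finite_subset[of _ "{0..<n} \<times> {0..<n}"]) (auto simp: fan_graph_def)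
qed (auto simp: fan_graph_def symmetric_def intro!: symI)

lemma connected_fan_graph:
  assumes "n \<ge> 1"
  shows "connected (with_proj (fan_graph n))"
proof -
  interpret pair_graph "fan_graph n" by (rule pair_graph_fan_graph)
  have hub: "u \<rightarrow>\<^sup>*\<^bsub>with_proj (fan_graph n)\<^esub> 0 \<and> 0 \<rightarrow>\<^sup>*\<^bsub>with_proj (fan_graph n)\<^esub> u"
    if "u < n" for u
  proof (cases "u = 0")
    case True
    moreover have "u \<in> pverts (fan_graph n)" using that by (simp add: fan_graph_def)
    ultimately show ?thesis by simp
  next
    case False
    then have "(u, 0) \<in> parcs (fan_graph n)" "(0, u) \<in> parcs (fan_graph n)"
      using that by (simp_all add: fan_graph_def)
    then show ?thesis by (simp add: reachable_adjI)
  qed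
  have "u \<rightarrow>\<^sup>*\<^bsub>with_proj (fan_graph n)\<^esub> v" if "u < n" "v < n" for u v
    using hub[OF that(1)] hub[OF that(2)] reachable_trans by blast
  moreover have "pverts (fan_graph n) = {0..<n}"
    by (simp add: fan_graph_def)
  ultimately show ?thesis
    unfolding connected_def strongly_connected_def
    using assms by (auto intro!: reachable_mk_symmetricI)
qed

end

theory Submission
  imports Defs "HOL-Number_Theory.Cong"
begin

text \<open>
  Only the trace \<open>{i - 1, i + 1} \<inter> S\<close> of the neighbourhood of a path vertex \<open>i \<notin> S\<close> matters.
  For the lower bound let \<open>T\<close> be the part of a resolving set on the path, \<open>k = card T\<close>, and let \<open>A\<close>
  and \<open>B\<close> be the path vertices outside \<open>T\<close> whose left, respectively right, neighbour is in \<open>T\<close>.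
  Then \<open>card A, card B \<le> k\<close>; distinct traces give \<open>card (A \<union> B) - card (A \<inter> B) \<le> k\<close>, as
  the difference counts the vertices with a one-element trace; and at most one vertex has an empty
  trace.  Hence \<open>2 * card (A \<union> B) \<le> 3 * k\<close> and \<open>n - 1 \<le> k + card (A \<union> B) + 1\<close>, which gives
  \<open>2 * (n - 2) \<le> 5 * k\<close>.  Taking two out of every five consecutive path vertices attains the bound.
\<close>

section \<open>Distances in the fan\<close>

lemma pverts_fan_graph [simp]: "pverts (fan_graph n) = {0..<n}"
  by (simp add: fan_graph_def)

lemma parcs_fan_graph_iff:
  "(u, v) \<in> parcs (fan_graph n) \<longleftrightarrow>
     u < n \<and> v < n \<and> u \<noteq> v \<and> (u = 0 \<or> v = 0 \<or> v = Suc u \<or> u = Suc v)"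
  by (simp add: fan_graph_def)

text \<open>The walk through the hub joins any two distinct path vertices in two steps, so it
  suffices to characterise the paths of length 0 and 1.\<close>

lemma graph_dist_fan_graph:
  assumes u: "u < n" and v: "v < n"
  shows "graph_dist (fan_graph n) u v =
    (if u = v then 0 else if u = 0 \<or> v = 0 \<or> v = Suc u \<or> u = Suc v then 1 else 2)"
proof -
  interpret pair_graph "fan_graph n" by (rule pair_graph_fan_graph)
  note defs = apath_def awalk_def parcs_fan_graph_iff
  have 0: "(\<exists>p. apath u p v \<and> length p = 0) \<longleftrightarrow> u = v"
    using u by (auto simp: defs)
  have 1: "(\<exists>p. apath u p v \<and> length p = 1) \<longleftrightarrow> (u, v) \<in> parcs (fan_graph n)"
    using u v by (auto simp: defs length_Suc_conv intro!: exI[of _ "[(u, v)]"])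
  have 2: "\<exists>p. apath u p v \<and> length p = 2" if "u \<noteq> v" "u \<noteq> 0" "v \<noteq> 0"
    using u v that by (intro exI[of _ "[(u, 0), (0, v)]"]) (auto simp: defs)
  consider (same) "u = v" | (adj) "u \<noteq> v" "u = 0 \<or> v = 0 \<or> v = Suc u \<or> u = Suc v"
    | (far) "u \<noteq> v" "u \<noteq> 0" "v \<noteq> 0" "v \<noteq> Suc u" "u \<noteq> Suc v" by blast
  then show ?thesis
  proof cases
    case same
    then show ?thesis unfolding graph_dist_def using 0 by (auto intro!: Least_equality)
  next
    case adj
    then have "(u, v) \<in> parcs (fan_graph n)" using u v by (simp add: parcs_fan_graph_iff)
    then have "(LEAST k. \<exists>p. apath u p v \<and> length p = k) = 1"
      using 0 1 adj by (intro Least_equality) (auto simp: Suc_le_eq)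
    then show ?thesis using adj by (simp add: graph_dist_def)
  next
    case far
    then have n1: "(u, v) \<notin> parcs (fan_graph n)" by (simp add: parcs_fan_graph_iff)
    have "2 \<le> k" if "\<exists>p. apath u p v \<and> length p = k" for k
    proof (rule ccontr)
      assume "\<not> 2 \<le> k"
      then have "k = 0 \<or> k = 1" by auto
      then show False using that 0 1 n1 far(1) by blast
    qed
    then have "(LEAST k. \<exists>p. apath u p v \<and> length p = k) = 2"
      using 2 far by (intro Least_equality) auto
    then show ?thesis using far by (simp add: graph_dist_def)
  qed
qed

section \<open>Lower bound for resolving sets\<close>

lemma resolving_set_fan_graph_card_ge:
  assumes S: "resolving_set (fan_graph n) S"
  shows "2 * (n - 2) \<le> 5 * card S"
proof -
  define N where "N = {1..<n}"
  define T where "T = S \<inter> N"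
  define A where "A = {i \<in> N - T. i - 1 \<in> T}"
  define B where "B = {i \<in> N - T. Suc i \<in> T}"
  define C where "C = N - T - (A \<union> B)"
  have SV: "S \<subseteq> {0..<n}" using S by (auto simp: resolving_set_def)
  then have finS: "finite S" using finite_subset by blast
  have fin: "finite N" "finite T" "finite A" "finite B" "finite C"
    by (auto simp: N_def T_def A_def B_def C_def)
  \<comment> \<open>Distinct path vertices outside \<open>T\<close> have distinct traces. The last
    two premises ask for equal traces only if one of them is nonempty, so for two empty traces they
    hold vacuously.\<close>
  have unique: "i = j"
    if "i \<in> N - T" "j \<in> N - T"
      "i - 1 \<in> T \<or> Suc i \<in> T \<Longrightarrow> \<forall>x\<in>T. (x = i - 1 \<or> x = Suc i) \<longleftrightarrow> (x = j - 1 \<or> x = Suc j)"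
      "j - 1 \<in> T \<or> Suc j \<in> T \<Longrightarrow> \<forall>x\<in>T. (x = i - 1 \<or> x = Suc i) \<longleftrightarrow> (x = j - 1 \<or> x = Suc j)"
    for i j
  proof (rule ccontr)
    assume "i \<noteq> j"
    have ij: "0 < i" "i < n" "0 < j" "j < n" "i \<notin> S" "j \<notin> S"
      using that(1,2) by (auto simp: N_def T_def)
    obtain x where x: "x \<in> S" "graph_dist (fan_graph n) i x \<noteq> graph_dist (fan_graph n) j x"
      using S ij \<open>i \<noteq> j\<close> unfolding resolving_set_def resolves_def
      by (metis atLeastLessThan_iff le0 pverts_fan_graph)
    have xn: "x < n" using x(1) SV by auto
    \<comment> \<open>The hub is at distance 1 from every path vertex, so it resolves no two of
      them.\<close>
    have x0: "x \<noteq> 0" using x(2) ij by (cases "x = 0") (simp_all add: graph_dist_fan_graph)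
    then have xT: "x \<in> T" using x(1) xn by (auto simp: T_def N_def)
    \<comment> \<open>Since \<open>x\<close> differs from \<open>i\<close> and \<open>j\<close>,
      both distances are 1 or 2, and 1 means being a neighbour on the path.\<close>
    have "(x = i - 1 \<or> x = Suc i) \<noteq> (x = j - 1 \<or> x = Suc j)"
      using x ij xn x0 by (auto simp: graph_dist_fan_graph split: if_splits)
    then show False using that(3,4) xT by blast
  qed
  have cA: "card A \<le> card T"
    by (rule card_inj_on_le[of "\<lambda>i. i - 1"]) (auto simp: fin A_def N_def inj_on_def)
  have cB: "card B \<le> card T"
    by (rule card_inj_on_le[of Suc]) (auto simp: fin B_def)
  have cC: "card C \<le> 1"
  proof -
    have "i = j" if "i \<in> C" "j \<in> C" for i j
      using that by (intro unique) (auto simp: C_def A_def B_def)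
    then show ?thesis using fin by (simp add: card_le_Suc0_iff_eq)
  qed
  define D where "D = A \<union> B - A \<inter> B"
  have cD: "card D \<le> card T"
  proof (rule card_inj_on_le)
    \<comment> \<open>On \<open>D\<close> the trace is a singleton, and \<open>?f\<close> picks its
      element.\<close>
    let ?f = "\<lambda>i. if i \<in> A then i - 1 else Suc i"
    show "?f ` D \<subseteq> T" by (auto simp: D_def A_def B_def)
    show "finite T" by (rule fin)
    have trace: "i \<in> N - T \<and> (\<forall>x\<in>T. (x = i - 1 \<or> x = Suc i) \<longleftrightarrow> x = ?f i)" if "i \<in> D" for i
      using that by (auto simp: D_def A_def B_def)
    show "inj_on ?f D"
    proof (rule inj_onI)
      fix i j assume "i \<in> D" "j \<in> D" and eq: "?f i = ?f j"
      note t = trace[OF \<open>i \<in> D\<close>] trace[OF \<open>j \<in> D\<close>]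
      have "\<forall>x\<in>T. (x = i - 1 \<or> x = Suc i) \<longleftrightarrow> (x = j - 1 \<or> x = Suc j)"
        using t eq by metis
      then show "i = j" using t by (intro unique) blast+
    qed
  qed
  have "card (A \<union> B) + card (A \<inter> B) = card A + card B"
    using card_Un_Int[of A B] fin by simp
  moreover have "card D + card (A \<inter> B) = card (A \<union> B)"
  proof -
    have "A \<union> B = D \<union> A \<inter> B" "D \<inter> (A \<inter> B) = {}" by (auto simp: D_def)
    then show ?thesis using card_Un_disjoint[of D "A \<inter> B"] fin by (simp add: D_def)
  qed
  \<comment> \<open>Add the bounds on the sum and on the difference of
    \<open>card (A \<union> B)\<close> and \<open>card (A \<inter> B)\<close>; the intersection
    cancels.\<close>
  ultimately have AB: "2 * card (A \<union> B) \<le> 3 * card T" using cA cB cD by linarith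
  have "N = T \<union> (A \<union> B) \<union> C" by (auto simp: C_def A_def B_def T_def)
  then have "card N \<le> card T + card (A \<union> B) + card C"
    by (metis (no_types, lifting) add_le_mono1 card_Un_le le_trans)
  moreover have "card N = n - 1" by (simp add: N_def)
  moreover have "card T \<le> card S" using finS by (auto simp: T_def intro: card_mono)
  ultimately show ?thesis using AB cC by linarith
qed

section \<open>Upper bound by a periodic resolving set\<close>

text \<open>
  The pattern with residues \<open>2, 4\<close> modulo \<open>5\<close> breaks down when the path has \<open>5 * q + 3\<close> vertices,
  since then \<open>5 * q + 1\<close> and \<open>5 * q + 3\<close> both have trace \<open>{5 * q + 2}\<close>.  Shifting the pattern by
  one repairs this, at the price of an empty trace at vertex \<open>1\<close>.
\<close>

definition fan_basis :: "nat \<Rightarrow> nat set" where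
  "fan_basis n =
     (if n mod 5 = 4 then {i \<in> {1..<n}. i mod 5 = 3 \<or> i mod 5 = 0}
      else {i \<in> {1..<n}. i mod 5 = 2 \<or> i mod 5 = 4})"

text \<open>The elements counted are \<open>r\<close>, \<open>r + d\<close>,
  \<open>r + 2 * d\<close> and so on up to \<open>m\<close>. Since counting starts at 1, the residue
  0 is represented by \<open>r = d\<close>. In the induction the quotient grows exactly when
  \<open>Suc m\<close> is congruent to \<open>r\<close>.\<close>

lemma card_mod_eq:
  assumes "0 < r" "r \<le> d"
  shows "card {i \<in> {1..<Suc m}. i mod d = r mod d} = (m + (d - r)) div d"
proof (induction m)
  case 0
  show ?case using assms by simp
next
  case (Suc m)
  have "Suc m + (d - r) = Suc (m + (d - r))" by simp
  moreover have "Suc (m + (d - r)) mod d = 0 \<longleftrightarrow> Suc m mod d = r mod d"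
  proof -
    have "[Suc m = r] (mod d) \<longleftrightarrow> [Suc m + (d - r) = r + (d - r)] (mod d)"
      by (simp only: cong_add_rcancel_nat)
    then show ?thesis using assms by (simp add: cong_def)
  qed
  moreover have "{i \<in> {1..<Suc (Suc m)}. i mod d = r mod d} =
      (if Suc m mod d = r mod d then {Suc m} else {}) \<union> {i \<in> {1..<Suc m}. i mod d = r mod d}"
    by (auto simp: less_Suc_eq)
  ultimately show ?case using Suc by (simp add: div_Suc)
qed

text \<open>No exact count is needed: \<open>2 * n\<close> exceeds \<open>2 * (n - 2)\<close> by
  only 4, so at most one multiple of 5 lies between the lower bound and this one.\<close>

lemma card_fan_basis_le: "5 * card (fan_basis n) \<le> 2 * n"
proof (cases n)
  case (Suc m)
  have or: "card {i \<in> {1..<Suc m}. i mod 5 = r mod 5 \<or> i mod 5 = s mod 5} =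
      (m + (5 - r)) div 5 + (m + (5 - s)) div 5"
    if "0 < r" "r \<le> 5" "0 < s" "s \<le> 5" "r mod 5 \<noteq> s mod 5" for r s :: nat
  proof -
    have "{i \<in> {1..<Suc m}. i mod 5 = r mod 5 \<or> i mod 5 = s mod 5} =
        {i \<in> {1..<Suc m}. i mod 5 = r mod 5} \<union> {i \<in> {1..<Suc m}. i mod 5 = s mod 5}"
      by blast
    moreover have "{i \<in> {1..<Suc m}. i mod 5 = r mod 5} \<inter> {i \<in> {1..<Suc m}. i mod 5 = s mod 5} = {}"
      using that by auto
    ultimately show ?thesis
      using card_mod_eq[of r 5 m] card_mod_eq[of s 5 m] that by (simp add: card_Un_disjoint)
  qed
  obtain q r where m: "m = 5 * q + r" "r < 5"
    by (metis mod_less_divisor mult_div_mod_eq zero_less_numeral)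
  then have r: "r = 0 \<or> r = 1 \<or> r = 2 \<or> r = 3 \<or> r = 4" by auto
  show ?thesis
  proof (cases "r = 3")
    case True
    then have "n mod 5 = 4" using m Suc by simp
    then have "card (fan_basis n) = (m + 2) div 5 + m div 5"
      using or[of 3 5] Suc by (simp add: fan_basis_def)
    then show ?thesis using m Suc True by simp
  next
    case False
    then have "n mod 5 \<noteq> 4" using m r Suc by auto
    then have "card (fan_basis n) = (m + 3) div 5 + (m + 1) div 5"
      using or[of 2 4] Suc by (simp add: fan_basis_def)
    then show ?thesis using m Suc False r by auto
  qed
qed (simp add: fan_basis_def)

text \<open>A basis vertex just left of \<open>u\<close> is never a neighbour of \<open>v\<close>,
  as \<open>u < v\<close>. One just right of \<open>u\<close> is shared only if
  \<open>v = u + 2\<close>, and then the right neighbour of \<open>v\<close> separates.\<close>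

lemma fan_basis_separates:
  assumes uv: "0 < u" "u < v" "v < n" and notin: "u \<notin> fan_basis n" "v \<notin> fan_basis n"
  shows "\<exists>x \<in> fan_basis n. (x = Suc u \<or> u = Suc x) \<noteq> (x = Suc v \<or> v = Suc x)"
proof (cases "n mod 5 = 4")
  case True
  have mem: "x \<in> fan_basis n \<longleftrightarrow> 0 < x \<and> x < n \<and> (x mod 5 = 3 \<or> x mod 5 = 0)" for x
    using True by (auto simp: fan_basis_def)
  have "u mod 5 \<noteq> 3" "u mod 5 \<noteq> 0" "v mod 5 \<noteq> 3" "v mod 5 \<noteq> 0"
    using uv notin mem[of u] mem[of v] by auto
  then have "u mod 5 = 1 \<or> u mod 5 = 2 \<or> u mod 5 = 4" "v mod 5 = 1 \<or> v mod 5 = 2 \<or> v mod 5 = 4"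
    by presburger+
  then consider "u mod 5 = 2" "v = u + 2" | "u mod 5 = 2" "v \<noteq> u + 2" | "u mod 5 = 4"
    | "u mod 5 = 1" "u \<noteq> 1" | "u = 1" "v mod 5 = 2" | "u = 1" "v mod 5 \<noteq> 2" by blast
  then show ?thesis
  proof cases
    case 1
    have res: "(u + 3) mod 5 = 0" using \<open>u mod 5 = 2\<close> by presburger
    \<comment> \<open>Here \<open>u + 3\<close> is the right neighbour of \<open>v\<close>; the
      residue of \<open>n\<close> ensures that \<open>v\<close> is not the end of the path.\<close>
    then have "u + 3 \<noteq> n" using True by auto
    then have "u + 3 \<in> fan_basis n" unfolding mem using uv 1 res by simp
    then show ?thesis
      using uv 1 by (intro bexI[of _ "u + 3"]) auto
  next
    case 2
    then have "(u + 1) mod 5 = 3" by presburger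
    then have "u + 1 \<in> fan_basis n" unfolding mem using uv 2 by auto
    then show ?thesis
      using uv 2 by (intro bexI[of _ "u + 1"]) auto
  next
    case 3
    then have "(u - 1) mod 5 = 3 \<and> 1 < u"
      using uv(1) by (cases u) (auto simp: mod_Suc split: if_splits intro!: gr0I)
    then have "u - 1 \<in> fan_basis n" unfolding mem using uv 3 by auto
    then show ?thesis
      using uv 3 by (intro bexI[of _ "u - 1"]) auto
  next
    case 4
    then have "(u - 1) mod 5 = 0 \<and> 1 < u"
      using uv(1) by (cases u) (auto simp: mod_Suc split: if_splits intro!: gr0I)
    then have "u - 1 \<in> fan_basis n" unfolding mem using uv 4 by auto
    then show ?thesis
      using uv 4 by (intro bexI[of _ "u - 1"]) auto
  next
    \<comment> \<open>Vertex 1 has an empty trace, so any basis neighbour of \<open>v\<close>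
      separates; it lies right of \<open>v\<close> here and left of \<open>v\<close> in the next
      case.\<close>
    case 5
    have res: "(v + 1) mod 5 = 3" using \<open>v mod 5 = 2\<close> by presburger
    then have "v + 1 \<noteq> n" using True by auto
    then have "v + 1 \<in> fan_basis n" unfolding mem using uv 5 res by simp
    then show ?thesis
      using uv 5 by (intro bexI[of _ "v + 1"]) auto
  next
    case 6
    then have v: "v mod 5 = 1 \<or> v mod 5 = 4"
      using \<open>v mod 5 = 1 \<or> v mod 5 = 2 \<or> v mod 5 = 4\<close> by blast
    then have "v \<noteq> 3" by auto
    have "(v - 1) mod 5 = 0 \<or> (v - 1) mod 5 = 3"
      using v uv by (cases v) (auto simp: mod_Suc split: if_splits)
    then have "v - 1 \<in> fan_basis n" unfolding mem using uv by auto
    then show ?thesis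
      using uv 6 \<open>v \<noteq> 3\<close> by (intro bexI[of _ "v - 1"]) auto
  qed
next
  case False
  have mem: "x \<in> fan_basis n \<longleftrightarrow> 0 < x \<and> x < n \<and> (x mod 5 = 2 \<or> x mod 5 = 4)" for x
    using False by (auto simp: fan_basis_def)
  have "u mod 5 \<noteq> 2" "u mod 5 \<noteq> 4" using uv notin mem[of u] by auto
  then have "u mod 5 = 0 \<or> u mod 5 = 1 \<or> u mod 5 = 3" by presburger
  then consider "u mod 5 = 1" "v = u + 2" | "u mod 5 = 1" "v \<noteq> u + 2"
    | "u mod 5 = 3 \<or> u mod 5 = 0" by metis
  then show ?thesis
  proof cases
    case 1
    have res: "(u + 3) mod 5 = 4" using \<open>u mod 5 = 1\<close> by presburger
    then have "u + 3 \<noteq> n" using False by auto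
    then have "u + 3 \<in> fan_basis n" unfolding mem using uv 1 res by simp
    then show ?thesis
      using uv 1 by (intro bexI[of _ "u + 3"]) auto
  next
    case 2
    then have "(u + 1) mod 5 = 2" by presburger
    then have "u + 1 \<in> fan_basis n" unfolding mem using uv 2 by auto
    then show ?thesis
      using uv 2 by (intro bexI[of _ "u + 1"]) auto
  next
    case 3
    then have "((u - 1) mod 5 = 2 \<or> (u - 1) mod 5 = 4) \<and> 1 < u"
      using uv(1) by (cases u) (auto simp: mod_Suc split: if_splits intro!: gr0I)
    then have "u - 1 \<in> fan_basis n" unfolding mem using uv 3 by auto
    then show ?thesis
      using uv 3 by (intro bexI[of _ "u - 1"]) auto
  qed
qed

text \<open>This separates the hub, which is adjacent to the whole basis, from a path vertex outside
  the basis. A vertex has at most two neighbours on the path, and \<open>n \<ge> 8\<close> provides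
  three basis vertices.\<close>

lemma fan_basis_nonadjacent:
  assumes "n \<ge> 8"
  shows "\<exists>x \<in> fan_basis n. x \<noteq> Suc u \<and> u \<noteq> Suc x"
proof (cases "n mod 5 = 4")
  case True
  then have "n \<ge> 9" using assms by presburger
  then have "3 \<in> fan_basis n" "5 \<in> fan_basis n" "8 \<in> fan_basis n"
    using True by (auto simp: fan_basis_def)
  moreover have "(3 \<noteq> Suc u \<and> u \<noteq> Suc 3) \<or> (5 \<noteq> Suc u \<and> u \<noteq> Suc 5) \<or> (8 \<noteq> Suc u \<and> u \<noteq> Suc 8)"
    by presburger
  ultimately show ?thesis by blast
next
  case False
  then have "2 \<in> fan_basis n" "4 \<in> fan_basis n" "7 \<in> fan_basis n"
    using assms by (auto simp: fan_basis_def)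
  moreover have "(2 \<noteq> Suc u \<and> u \<noteq> Suc 2) \<or> (4 \<noteq> Suc u \<and> u \<noteq> Suc 4) \<or> (7 \<noteq> Suc u \<and> u \<noteq> Suc 7)"
    by presburger
  ultimately show ?thesis by blast
qed

lemma resolving_set_fan_basis:
  assumes n: "n \<ge> 8"
  shows "resolving_set (fan_graph n) (fan_basis n)"
proof -
  have sub: "x \<in> fan_basis n \<Longrightarrow> 0 < x \<and> x < n" for x
    by (auto simp: fan_basis_def split: if_splits)
  have resolved: "\<exists>x \<in> fan_basis n. resolves (fan_graph n) x u v" if uv: "u < v" "v < n" for u v
  proof -
    consider "u \<in> fan_basis n" | "v \<in> fan_basis n"
      | (hub) "u = 0" "v \<notin> fan_basis n" | (path) "0 < u" "u \<notin> fan_basis n" "v \<notin> fan_basis n"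
      by blast
    then show ?thesis
    proof cases
      case 1
      then show ?thesis
        using that by (intro bexI[of _ u]) (auto simp: resolves_def graph_dist_fan_graph)
    next
      case 2
      then show ?thesis
        using that by (intro bexI[of _ v]) (auto simp: resolves_def graph_dist_fan_graph)
    next
      case hub
      obtain x where "x \<in> fan_basis n" "x \<noteq> Suc v" "v \<noteq> Suc x"
        using fan_basis_nonadjacent[OF n] by blast
      then show ?thesis
        using that hub sub[of x]
        by (intro bexI[of _ x]) (auto simp: resolves_def graph_dist_fan_graph)
    next
      case path
      obtain x where x: "x \<in> fan_basis n" "(x = Suc u \<or> u = Suc x) \<noteq> (x = Suc v \<or> v = Suc x)"
        using fan_basis_separates[OF path(1) uv path(2,3)] by blast
      then have "x \<noteq> u" "x \<noteq> v" using path by auto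
      then show ?thesis
        using that path sub[of x] x
        by (intro bexI[of _ x]) (auto simp: resolves_def graph_dist_fan_graph)
    qed
  qed
  have "\<exists>x \<in> fan_basis n. resolves (fan_graph n) x u v" if "u \<noteq> v" "u < n" "v < n" for u v
    using that resolved[of u v] resolved[of v u] unfolding resolves_def
    by (metis linorder_neqE_nat)
  then show ?thesis
    using sub by (auto simp: resolving_set_def)
qed

theorem theorem5:
  fixes n :: nat
  assumes "n \<ge> 8"
  shows "int (metric_dimension (fan_graph n)) = \<lceil>2 * (real n - 2) / 5\<rceil>"
proof -
  let ?P = "\<lambda>k. \<exists>S. resolving_set (fan_graph n) S \<and> card S = k"
  have "?P (card (fan_basis n))"
    using resolving_set_fan_basis[OF assms] by blast
  then have "?P (metric_dimension (fan_graph n))"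
    and "metric_dimension (fan_graph n) \<le> card (fan_basis n)"
    unfolding metric_dimension_def by (rule LeastI, rule Least_le)
  then have "2 * (n - 2) \<le> 5 * metric_dimension (fan_graph n)"
    "5 * metric_dimension (fan_graph n) \<le> 2 * n"
    using resolving_set_fan_graph_card_ge card_fan_basis_le[of n] by (metis, linarith)
  then show ?thesis
    using assms by (intro ceiling_unique[symmetric]) (auto simp: field_simps)
qed

end
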